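(* Let $(a_{i,j})_{i,j\ge 1}$ be independent and identically distributed real random variables with $\mathbb E[a_{1,1}]=0$ and $\mathbb E[a_{1,1}^2]=1$, and for $n\ge 1$ let $$F_n(x,y)=\frac1n\sum_{1\le i,j\le n}a_{i,j}\cos\left(\frac{ix}{n}\right)\cos\left(\frac{jy}{n}\right),\qquad (x,y)\in\mathbb R^2 .$$ Then for any $\theta$ with $1<\theta<\frac32$ there exists a constant $C>0$ such that for all $n\ge1$, all $\epsilon>0$ and all non-negative integers $k,l$ satisfying $\mathrm{ord}(k)\ge\sqrt n$ and $\mathrm{ord}(l)\ge\sqrt n$, $$\mathbb P\left(\left|F_n(k\pi,l\pi)\right|\le\epsilon\right)\le C\left(\epsilon+\frac1{n^\theta}\right).$$
   Context: For a positive integer $n$ and $p\in\mathbb N$, $\mathrm{ord}(p)=\frac{n}{\gcd(p,n)}$ denotes the order of $p$ in the additive group $\mathbb Z/n\mathbb Z$. *)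

theory Defs
  imports "HOL-Probability.Probability"
begin

definition add_ord :: "nat \<Rightarrow> nat \<Rightarrow> nat" where
  "add_ord n p = n div gcd p n"

lemma add_ord_dvd_iff:
  assumes "n \<ge> 1"
  shows "n dvd m * p \<longleftrightarrow> add_ord n p dvd m"
proof -
  define g where "g = gcd p n"
  have g: "g > 0" "g dvd p" "g dvd n" using assms by (auto simp: g_def)
  have c: "coprime (n div g) (p div g)"
    using assms div_gcd_coprime[of n p] by (simp add: g_def gcd.commute)
  have "n dvd m * p \<longleftrightarrow> g * (n div g) dvd g * (m * (p div g))"
    using dvd_mult_div_cancel[OF g(2)] dvd_mult_div_cancel[OF g(3)]
    by (metis mult.left_commute)
  also have "\<dots> \<longleftrightarrow> n div g dvd m * (p div g)"
    using g(1) by (simp only: nat_mult_dvd_cancel1)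
  also have "\<dots> \<longleftrightarrow> n div g dvd m"
    using c by (simp add: coprime_dvd_mult_left_iff)
  finally show ?thesis by (simp add: add_ord_def g_def)
qed

definition rand_F ::
  "(nat \<Rightarrow> nat \<Rightarrow> 'a \<Rightarrow> real) \<Rightarrow> nat \<Rightarrow> real \<Rightarrow> real \<Rightarrow> 'a \<Rightarrow> real" where
  "rand_F a n x y \<omega> =
     1 / real n * (\<Sum>i = 1..n. \<Sum>j = 1..n.
       a i j \<omega> * cos (real i * x / real n) * cos (real j * y / real n))"

end

theory Submission
  imports Defs "HOL-Real_Asymp.Real_Asymp"
begin

text \<open>
  By an Esseen-type inequality, the probability that \<open>F\<^sub>n\<close> lies within \<open>1/T\<close> of zero, \<open>T \<le> n\<^sup>\<theta>\<close>,
  is bounded by a Gaussian average of the characteristic function \<open>\<phi>(Tz)\<close>, where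
  \<open>\<phi>(t)\<close> is the product of \<open>\<chi>(t cos(ik\<pi>/n) cos(jl\<pi>/n) / n)\<close> and \<open>\<chi>\<close> belongs to a single coefficient;
  \<open>|\<chi>(u)| \<le> exp(-u\<^sup>2/4)\<close> for \<open>|u| \<le> c\<close>. For \<open>|t| \<le> cn\<close> all factors are in this range and
  \<open>|\<phi>(t)| \<le> exp(-t\<^sup>2/16)\<close>, which integrates to \<open>O(1/T)\<close>. For larger \<open>|t|\<close>, still far below \<open>n\<^sup>3\<^sup>/\<^sup>2\<close>,
  the values \<open>|cos(ik\<pi>/n)|\<close> form a \<open>\<pi>/ord(k)\<close>-dense set, and \<open>\<pi>/ord(k) \<le> \<pi>/\<surd>n\<close> is so fine that for
  each of the at least \<open>n/4\<close> indices \<open>j\<close> with \<open>|cos(jl\<pi>/n)| \<ge> 1/2\<close> some \<open>i\<close> puts the argument of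
  \<open>\<chi>\<close> into \<open>[c/4, c/2]\<close> up to sign; hence \<open>\<phi>(t)\<close> is exponentially small in \<open>n\<close>.
\<close>

section \<open>Smoothing inequality and Gaussian integrals\<close>

text \<open>
  The Gaussian is its own characteristic function, so Fubini turns \<open>E exp(-(TX)\<^sup>2/2)\<close> into a
  Gaussian average of the characteristic function of \<open>X\<close>.
\<close>
lemma esseen_gaussian:
  fixes T :: real
  assumes "real_distribution M" "T > 0"
  shows "measure M {x. \<bar>x\<bar> \<le> 1 / T}
    \<le> exp (1 / 2) * (LINT z|std_normal_distribution. cmod (char M (T * z)))"
proof -
  interpret M: real_distribution M by fact
  interpret Z: real_distribution std_normal_distribution by (rule real_dist_normal_dist)
  interpret P: pair_prob_space M std_normal_distribution ..
  have int: "integrable M (\<lambda>x. exp (- (T * x)\<^sup>2 / 2))"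
    by (rule M.integrable_const_bound[where B = 1]) auto
  have "measure M {x. \<bar>x\<bar> \<le> 1 / T} = (LINT x|M. indicator {x. \<bar>x\<bar> \<le> 1 / T} x)"
    by simp
  also have "\<dots> \<le> (LINT x|M. exp (1 / 2) * exp (- (T * x)\<^sup>2 / 2))"
  proof (rule integral_mono)
    show "integrable M (\<lambda>x. indicator {x. \<bar>x\<bar> \<le> 1 / T} x :: real)"
      by (rule M.integrable_const_bound[where B = 1]) (auto simp: indicator_def)
    show "integrable M (\<lambda>x. exp (1 / 2) * exp (- (T * x)\<^sup>2 / 2))"
      using int by simp
    fix x
    have "(T * x)\<^sup>2 \<le> 1" if "\<bar>x\<bar> \<le> 1 / T"
    proof -
      have "\<bar>T * x\<bar> \<le> 1" using that \<open>T > 0\<close> by (simp add: abs_mult field_simps)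
      then show ?thesis by (simp add: abs_square_le_1)
    qed
    then show "indicator {x. \<bar>x\<bar> \<le> 1 / T} x \<le> exp (1 / 2) * exp (- (T * x)\<^sup>2 / 2)"
      by (auto simp: indicator_def simp flip: exp_add)
  qed
  also have "\<dots> = exp (1 / 2) * (LINT x|M. exp (- (T * x)\<^sup>2 / 2))"
    by simp
  also have "(LINT x|M. exp (- (T * x)\<^sup>2 / 2)) \<le>
      (LINT z|std_normal_distribution. cmod (char M (T * z)))"
  proof -
    have "complex_of_real (LINT x|M. exp (- (T * x)\<^sup>2 / 2)) =
        (LINT x|M. char std_normal_distribution (T * x))"
      by (simp add: char_std_normal_distribution)
    also have "\<dots> = (LINT x|M. LINT z|std_normal_distribution. iexp (T * x * z))"
      by (simp add: char_def)
    also have "\<dots> = (LINT z|std_normal_distribution. LINT x|M. iexp (T * x * z))"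
    proof (rule P.Fubini_integral[symmetric])
      show "integrable (M \<Otimes>\<^sub>M std_normal_distribution) (\<lambda>(x, z). iexp (T * x * z))"
        by (rule P.integrable_const_bound[where B = 1]) (auto simp: split_beta)
    qed
    also have "\<dots> = (LINT z|std_normal_distribution. char M (T * z))"
      by (simp add: char_def mult_ac)
    finally have "cmod (complex_of_real (LINT x|M. exp (- (T * x)\<^sup>2 / 2))) \<le>
        (LINT z|std_normal_distribution. cmod (char M (T * z)))"
      by (metis integral_norm_bound)
    then show ?thesis by simp
  qed
  finally show ?thesis by simp
qed

lemma gaussian_integral:
  fixes s :: real
  assumes "s > 0"
  shows "integrable lborel (\<lambda>z. exp (- (z\<^sup>2) / (2 * s\<^sup>2)))"
    and "(LINT z|lborel. exp (- (z\<^sup>2) / (2 * s\<^sup>2))) = sqrt (2 * pi) * s"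
proof -
  have eq: "exp (- (z\<^sup>2) / (2 * s\<^sup>2)) = sqrt (2 * pi) * s * normal_density 0 s z" for z
    using assms by (simp add: normal_density_def real_sqrt_mult)
  show "integrable lborel (\<lambda>z. exp (- (z\<^sup>2) / (2 * s\<^sup>2)))"
    unfolding eq using integrable_normal_density[OF assms, of 0] by simp
  show "(LINT z|lborel. exp (- (z\<^sup>2) / (2 * s\<^sup>2))) = sqrt (2 * pi) * s"
    unfolding eq using integral_normal_density[OF assms, of 0] by simp
qed

section \<open>Characteristic function of a standardized variable near zero\<close>

text \<open>Second-order Taylor expansion: the remainder is at most \<open>t^2 / 6 * h t\<close>.
  The minimum in \<open>h\<close> keeps it integrable with only a second moment, and dominated
  convergence makes it small near 0. Once \<open>h t\<close> is below 3/2, the remainder uses up at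
  most half of the quadratic term, which leaves 1 - t^2/4.\<close>

lemma (in real_distribution) char_le_exp_near_zero:
  assumes "integrable M (\<lambda>x. x)" "expectation (\<lambda>x. x) = 0"
    and "integrable M (\<lambda>x. x\<^sup>2)" "expectation (\<lambda>x. x\<^sup>2) = 1"
  obtains c where "c > 0" "\<And>t. \<bar>t\<bar> \<le> c \<Longrightarrow> cmod (char M t) \<le> exp (- t\<^sup>2 / 4)"
proof -
  define h where "h t = expectation (\<lambda>x. min (6 * x\<^sup>2) (\<bar>t\<bar> * \<bar>x\<bar> ^ 3))" for t
  have int: "integrable M (\<lambda>x. min (6 * x\<^sup>2) (\<bar>t\<bar> * \<bar>x\<bar> ^ 3))" for t
    by (rule Bochner_Integration.integrable_bound[where f = "\<lambda>x. 6 * x\<^sup>2"])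
      (use assms(3) in auto)
  have "(\<lambda>m. h (1 / real (Suc m))) \<longlonglongrightarrow> expectation (\<lambda>x. 0)"
    unfolding h_def
  proof (rule integral_dominated_convergence[where w = "\<lambda>x. 6 * x\<^sup>2"])
    show "AE x in M. (\<lambda>m. min (6 * x\<^sup>2) (\<bar>1 / real (Suc m)\<bar> * \<bar>x\<bar> ^ 3)) \<longlonglongrightarrow> 0"
    proof (rule AE_I2)
      fix x :: real
      have "(\<lambda>m. min (6 * x\<^sup>2) (\<bar>1 / real (Suc m)\<bar> * \<bar>x\<bar> ^ 3)) \<longlonglongrightarrow> min (6 * x\<^sup>2) (\<bar>0\<bar> * \<bar>x\<bar> ^ 3)"
        using LIMSEQ_inverse_real_of_nat by (intro tendsto_intros) (simp add: inverse_eq_divide)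
      then show "(\<lambda>m. min (6 * x\<^sup>2) (\<bar>1 / real (Suc m)\<bar> * \<bar>x\<bar> ^ 3)) \<longlonglongrightarrow> 0"
        by (simp only: abs_zero mult_zero_left min_absorb2 zero_le_power2 zero_le_mult_iff zero_le_numeral) simp
    qed
  qed (use assms(3) in auto)
  then have "eventually (\<lambda>m. h (1 / real (Suc m)) < 3 / 2) sequentially"
    by (intro order_tendstoD(2)[where y = 0]) auto
  then obtain m where m: "h (1 / real (Suc m)) < 3 / 2"
    by (auto simp: eventually_sequentially)
  have "cmod (char M t) \<le> exp (- t\<^sup>2 / 4)" if t: "\<bar>t\<bar> \<le> 1 / real (Suc m)" for t
  proof -
    \<comment> \<open>\<open>h\<close> grows with |t|, so its value at the endpoint controls the
      whole interval.\<close>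
    have "h t \<le> h (1 / real (Suc m))"
      unfolding h_def by (intro integral_mono int min.mono mult_right_mono) (use t in auto)
    then have ht: "t\<^sup>2 / 6 * h t \<le> t\<^sup>2 / 6 * (3 / 2)"
      using m by (intro mult_left_mono) auto
    have "\<bar>t\<bar> \<le> 1" using t by (rule order_trans) simp
    then have "t\<^sup>2 \<le> 1" by (simp add: abs_square_le_1)
    have "cmod (char M t - of_real (1 - t\<^sup>2 / 2)) \<le> t\<^sup>2 / 6 * h t"
      using char_approx3[of 1 t] assms by (simp add: h_def)
    moreover have "cmod (char M t) \<le> cmod (char M t - of_real (1 - t\<^sup>2 / 2)) + cmod (of_real (1 - t\<^sup>2 / 2))"
      using norm_triangle_sub by (metis add.commute)
    moreover have "cmod (of_real (1 - t\<^sup>2 / 2)) = 1 - t\<^sup>2 / 2"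
      using \<open>t\<^sup>2 \<le> 1\<close> by (simp only: norm_of_real)
    ultimately have "cmod (char M t) \<le> 1 + (- t\<^sup>2 / 4)" using ht by linarith
    also have "\<dots> \<le> exp (- t\<^sup>2 / 4)" by (rule exp_ge_add_one_self)
    finally show ?thesis .
  qed
  then show ?thesis by (intro that[of "1 / real (Suc m)"]) auto
qed

section \<open>Size and density of the values cos(ik pi/n)\<close>

text \<open>By the double angle formula the excess over n/2 is half the sum of cos(2ix) with x = k
  pi/n. Multiplying that sum by 2 sin x makes it telescope over full periods, so it vanishes unless
  sin x = 0, where every term is 1. In both cases it is nonnegative.\<close>

lemma cos_square_sum_ge:
  fixes n k :: nat
  assumes "n \<ge> 1"
  shows "real n / 2 \<le> (\<Sum>i = 1..n. (cos (real i * (real k * pi) / real n))\<^sup>2)"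
proof -
  define x where "x = real k * pi / real n"
  have tele: "2 * sin x * (\<Sum>i = 1..m. cos (2 * (real i * x))) = sin (2 * real m * x + x) - sin x" for m
  proof (induction m)
    case (Suc m)
    have "2 * sin x * cos (2 * (real (Suc m) * x)) =
        sin (2 * real (Suc m) * x + x) - sin (2 * real m * x + x)"
      using sin_add[of "2 * (real (Suc m) * x)" x] sin_diff[of "2 * (real (Suc m) * x)" x]
      by (simp add: algebra_simps)
    with Suc show ?case by (simp add: algebra_simps)
  qed simp
  have per: "2 * real n * x = 2 * pi * real k"
    using assms by (simp add: x_def)
  have "0 \<le> (\<Sum>i = 1..n. cos (2 * (real i * x)))"
  proof (cases "sin x = 0")
    case True
    then obtain m where m: "x = of_int m * pi" by (auto simp: sin_zero_iff_int2)
    have "cos (2 * (real i * x)) = 1" for i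
      using cos_int_2pin[of "int i * m"] unfolding m by (simp add: mult_ac)
    then show ?thesis by simp
  next
    case False
    have "sin (2 * real n * x + x) = sin x"
      unfolding per using sin_int_2pin[of "int k"] cos_int_2pin[of "int k"] by (simp add: sin_add)
    with tele[of n] False show ?thesis by simp
  qed
  moreover have "(\<Sum>i = 1..n. (cos (real i * x))\<^sup>2) = real n / 2 + (\<Sum>i = 1..n. cos (2 * (real i * x))) / 2"
    by (simp add: cos_double_cos sum.distrib sum_divide_distrib diff_divide_distrib sum_subtractf)
  ultimately show ?thesis by (simp add: x_def mult.assoc)
qed

text \<open>In the sum of squares, which is at least n/2, indices outside the set contribute at most
  1/4 each and those inside at most 1.\<close>

lemma card_cos_ge_half:
  fixes n k :: nat
  assumes "n \<ge> 1"
  shows "real n / 4 \<le> real (card {i \<in> {1..n}. 1 / 2 \<le> \<bar>cos (real i * (real k * pi) / real n)\<bar>})"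
proof -
  let ?c = "\<lambda>i. cos (real i * (real k * pi) / real n)"
  let ?B = "{i \<in> {1..n}. 1 / 2 \<le> \<bar>?c i\<bar>}"
  have "real n / 2 \<le> (\<Sum>i = 1..n. (?c i)\<^sup>2)" by (rule cos_square_sum_ge[OF assms])
  also have "\<dots> \<le> (\<Sum>i = 1..n. indicator ?B i + 1 / 4)"
  proof (rule sum_mono)
    fix i assume i: "i \<in> {1..n}"
    have "(?c i)\<^sup>2 \<le> 1" by (simp add: abs_square_le_1)
    moreover have "(?c i)\<^sup>2 \<le> 1 / 4" if "\<bar>?c i\<bar> \<le> 1 / 2"
      using power_mono[OF that, of 2] by (simp add: power2_eq_square)
    ultimately show "(?c i)\<^sup>2 \<le> indicator ?B i + 1 / 4"
      using i by (auto simp: indicator_def)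
  qed
  also have "\<dots> = real (card ?B) + real n / 4"
    by (simp add: sum.distrib indicator_def of_bool_def sum.If_cases Int_def)
  finally show ?thesis by simp
qed

lemma abs_cos_add_int_pi: "\<bar>cos (x + of_int m * pi)\<bar> = \<bar>cos x\<bar>" for x :: real
  by (simp add: cos_add abs_mult mult.commute[of "of_int m" pi] cos_npi_int)

text \<open>Write k/n = p/q in lowest terms, q being the order of k. As p is invertible modulo q,
  the angles ik pi/n cover all multiples of pi/q modulo pi, and |cos| has period pi. Since cos is
  1-Lipschitz, its preimage of [a, b] in [0, pi] is at least as long as b - a, hence contains a
  multiple of pi/q.\<close>

lemma ex_abs_cos_between:
  fixes n k :: nat and a b :: real
  assumes "n \<ge> 1" "0 \<le> a" "b \<le> 1" "pi / real (add_ord n k) \<le> b - a"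
  shows "\<exists>i\<in>{1..n}. \<bar>cos (real i * (real k * pi) / real n)\<bar> \<in> {a..b}"
proof -
  define g p q where "g = gcd k n" and "p = k div g" and "q = add_ord n k"
  have g: "g > 0" "k = p * g" "n = q * g"
    using assms(1) by (auto simp: g_def p_def q_def add_ord_def)
  have "q > 0" "q \<le> n" using g assms(1) by (auto intro: Nat.gr0I)
  have cop: "coprime p q"
    using assms(1) div_gcd_coprime[of k n] by (simp add: p_def q_def g_def add_ord_def)
  have ab: "a \<le> b" using assms(4) \<open>q > 0\<close> unfolding q_def[symmetric]
    by (smt (verit) divide_nonneg_nonneg of_nat_0_le_iff pi_ge_zero)
  define x y where "x = arccos b" and "y = arccos a"
  have xy: "0 \<le> x" "y \<le> pi" "cos x = b" "cos y = a" "x \<le> y"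
    using assms ab by (auto simp: x_def y_def arccos_lbound arccos_ubound intro!: arccos_le_arccos)
  have "b - a = 2 * sin ((x + y) / 2) * sin ((y - x) / 2)"
    using cos_diff_cos[of x y] xy by simp
  also have "\<dots> \<le> \<bar>2 * sin ((x + y) / 2) * sin ((y - x) / 2)\<bar>" by (rule abs_ge_self)
  also have "\<dots> \<le> 2 * 1 * \<bar>(y - x) / 2\<bar>"
    unfolding abs_mult using abs_sin_x_le_abs_x[of "(y - x) / 2"] by (intro mult_mono) auto
  finally have "pi / real q \<le> y - x" using assms(4) xy by (simp add: q_def)
  \<comment> \<open>The largest multiple of pi/q not exceeding y; it is still at least x because y -
    x is at least pi/q.\<close>
  define r where "r = \<lfloor>y * real q / pi\<rfloor>"
  have "of_int r \<le> y * real q / pi" "y * real q / pi < of_int r + 1"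
    by (simp_all add: r_def)
  then have r: "of_int r * pi / real q \<le> y" "y < of_int r * pi / real q + pi / real q"
    using \<open>q > 0\<close> by (auto simp: field_simps)
  then have r2: "x \<le> of_int r * pi / real q" using \<open>pi / real q \<le> y - x\<close> by simp
  have "cos y \<le> cos (of_int r * pi / real q)" "cos (of_int r * pi / real q) \<le> cos x"
    using r r2 xy by (auto intro!: cos_monotone_0_pi_le)
  then have cr: "\<bar>cos (of_int r * pi / real q)\<bar> \<in> {a..b}" using xy assms by auto
  \<comment> \<open>The Bezout coefficient \<open>u\<close> inverts \<open>p\<close> modulo
    \<open>q\<close>, so \<open>u * r\<close> solves p v = r modulo q.\<close>
  obtain u u' where u: "u * int p + u' * int q = 1"
    using bezout_int[of "int p" "int q"] cop by (auto simp: coprime_iff_gcd_eq_1)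
  \<comment> \<open>Shifting by 1 before and after the reduction picks the representative in 1..q
    instead of 0..q-1, since the index 0 is not allowed.\<close>
  define v where "v = (u * r - 1) mod int q + 1"
  have v: "1 \<le> v" "v \<le> int q"
    using \<open>q > 0\<close> pos_mod_bound[of "int q" "u * r - 1"] pos_mod_sign[of "int q" "u * r - 1"]
    unfolding v_def by linarith+
  define m where "m = - (u' * r + int p * ((u * r - 1) div int q))"
  have "v = u * r - int q * ((u * r - 1) div int q)"
    unfolding v_def by (simp add: minus_mult_div_eq_mod[symmetric])
  then have "int p * v = int p * (u * r - int q * ((u * r - 1) div int q))" by (rule arg_cong)
  also have "\<dots> = (u * int p) * r - int q * (int p * ((u * r - 1) div int q))"
    by (simp add: algebra_simps)
  also have "u * int p = 1 - u' * int q" using u by simp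
  finally have m: "int p * v = r + m * int q"
    by (simp add: m_def algebra_simps)
  have "real (nat v) * (real k * pi) / real n = of_int (int p * v) * pi / real q"
    using v g \<open>q > 0\<close> by (simp add: field_simps)
  also have "\<dots> = of_int r * pi / real q + of_int m * pi"
    unfolding m using \<open>q > 0\<close> by (simp add: field_simps)
  finally have "\<bar>cos (real (nat v) * (real k * pi) / real n)\<bar> \<in> {a..b}"
    using cr by (simp only: abs_cos_add_int_pi)
  moreover have "nat v \<in> {1..n}" using v \<open>q \<le> n\<close> by auto
  ultimately show ?thesis by blast
qed

section \<open>From a bound on the characteristic function to a small-ball probability\<close>

text \<open>The Gaussian average of \<open>esseen_gaussian\<close> is split at |z| = A. Inside, the
  assumed bound integrates to a multiple of 1/T plus at most r. Outside, the characteristic function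
  is at most 1, and half of the exponent z^2/2 is spent on the factor exp(-A^2/4) while the other
  half stays integrable.\<close>

lemma (in real_distribution) prob_le_of_char_bound:
  fixes T A r :: real
  assumes "T > 0" "A \<ge> 0" "r \<ge> 0"
    and char_le: "\<And>z. \<bar>z\<bar> \<le> A \<Longrightarrow> cmod (char M (T * z)) \<le> exp (- (T * z)\<^sup>2 / 16) + r"
  shows "prob {x. \<bar>x\<bar> \<le> 1 / T}
    \<le> exp (1 / 2) * (sqrt (2 * pi) * sqrt 8 / T + r + exp (- A\<^sup>2 / 4) * (sqrt (2 * pi) * sqrt 2))"
proof -
  \<comment> \<open>The standard deviation for which exp(-z^2/(2 s^2)) equals
    exp(-(Tz)^2/16).\<close>
  define s where "s = sqrt 8 / T"
  have "s > 0" using assms by (simp add: s_def)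
  have s2: "2 * s\<^sup>2 = 16 / T\<^sup>2" by (simp add: s_def power_divide)
  let ?f = "\<lambda>z. exp (- (z\<^sup>2) / (2 * s\<^sup>2)) + r * std_normal_density z
    + exp (- A\<^sup>2 / 4) * exp (- (z\<^sup>2) / (2 * (sqrt 2)\<^sup>2))"
  have "(LINT z|std_normal_distribution. cmod (char M (T * z)))
      = (LINT z|lborel. std_normal_density z * cmod (char M (T * z)))"
    by (subst integral_density) auto
  also have "\<dots> \<le> (LINT z|lborel. ?f z)"
  proof (rule integral_mono)
    show "integrable lborel (\<lambda>z. std_normal_density z * cmod (char M (T * z)))"
      by (rule Bochner_Integration.integrable_bound[OF integrable_normal_density[of 1 0]])
        (auto simp: mult_left_le cmod_char_le_1)
    show "integrable lborel ?f"
      using gaussian_integral(1)[of s] gaussian_integral(1)[of "sqrt 2"] \<open>s > 0\<close>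
      by (intro Bochner_Integration.integrable_add integrable_mult_right) auto
    fix z :: real
    have "1 / sqrt (2 * pi) \<le> 1" using pi_gt3 by simp
    then have dens: "std_normal_density z \<le> exp (- z\<^sup>2 / 2)"
      unfolding std_normal_density_def by (intro mult_left_le_one_le) auto
    then have dens1: "std_normal_density z \<le> 1" by (rule order_trans) simp
    show "std_normal_density z * cmod (char M (T * z)) \<le> ?f z"
    proof (cases "\<bar>z\<bar> \<le> A")
      case True
      have "exp (- (T * z)\<^sup>2 / 16) = exp (- (z\<^sup>2) / (2 * s\<^sup>2))"
        unfolding s2 by (simp add: power_mult_distrib mult.commute)
      with char_le[OF True] have "std_normal_density z * cmod (char M (T * z)) \<le>
          std_normal_density z * (exp (- (z\<^sup>2) / (2 * s\<^sup>2)) + r)"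
        by (intro mult_left_mono) auto
      also have "\<dots> \<le> exp (- (z\<^sup>2) / (2 * s\<^sup>2)) + r * std_normal_density z"
        using dens1 by (simp add: distrib_left mult.commute mult_left_le)
      finally show ?thesis by (smt (verit) exp_gt_zero mult_pos_pos)
    next
      case False
      then have "A\<^sup>2 \<le> z\<^sup>2" using assms(2) by (simp add: abs_le_square_iff[symmetric])
      have "std_normal_density z * cmod (char M (T * z)) \<le> exp (- z\<^sup>2 / 2) * 1"
        using dens by (intro mult_mono cmod_char_le_1) auto
      also have "\<dots> \<le> exp (- A\<^sup>2 / 4) * exp (- (z\<^sup>2) / (2 * (sqrt 2)\<^sup>2))"
        using \<open>A\<^sup>2 \<le> z\<^sup>2\<close> by (simp flip: exp_add)
      finally show ?thesis using \<open>r \<ge> 0\<close>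
        by (smt (verit) exp_gt_zero mult_nonneg_nonneg normal_density_nonneg)
    qed
  qed
  also have "\<dots> = sqrt (2 * pi) * s + r + exp (- A\<^sup>2 / 4) * (sqrt (2 * pi) * sqrt 2)"
  proof -
    note g = gaussian_integral[OF \<open>s > 0\<close>] gaussian_integral[of "sqrt 2", simplified]
    have d: "integrable lborel std_normal_density" "integral\<^sup>L lborel std_normal_density = 1"
      by auto
    show ?thesis
      using g d by (simp add: Bochner_Integration.integral_add)
  qed
  finally show ?thesis
    using esseen_gaussian[OF real_distribution_axioms \<open>T > 0\<close>] unfolding s_def
    by (auto elim!: order_trans intro!: mult_left_mono)
qed

section \<open>Decay of the characteristic function of a weighted sum\<close>

text \<open>A decay rate usable at every frequency: outside \<open>[-c, c]\<close> only \<open>|\<chi>| \<le> 1\<close> is available.\<close>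
definition freq_decay :: "real \<Rightarrow> real \<Rightarrow> real" where
  "freq_decay c u = (if \<bar>u\<bar> \<le> c then u\<^sup>2 / 4 else 0)"

lemma freq_decay_nonneg: "0 \<le> freq_decay c u"
  by (simp add: freq_decay_def)

text \<open>Independence turns the characteristic function into a product, and each weight moves
  into the argument of the common factor; the decay rates then add up in the exponent.\<close>

lemma (in prob_space) cmod_char_weighted_sum_le:
  fixes X :: "'i \<Rightarrow> 'a \<Rightarrow> real" and w :: "'i \<Rightarrow> real"
  assumes "finite I" and ind: "indep_vars (\<lambda>_. borel) X I"
    and D: "\<And>p. p \<in> I \<Longrightarrow> distr M borel (X p) = D"
    and h: "\<And>u. cmod (char D u) \<le> exp (- h u)"
  shows "cmod (char (distr M borel (\<lambda>\<omega>. \<Sum>p\<in>I. w p * X p \<omega>)) t) \<le> exp (- (\<Sum>p\<in>I. h (t * w p)))"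
proof -
  have "indep_vars (\<lambda>_. borel) (\<lambda>p \<omega>. w p * X p \<omega>) I"
    using ind by (rule indep_vars_compose2) auto
  then have "char (distr M borel (\<lambda>\<omega>. \<Sum>p\<in>I. w p * X p \<omega>)) t =
      (\<Prod>p\<in>I. char (distr M borel (\<lambda>\<omega>. w p * X p \<omega>)) t)"
    by (rule char_distr_sum)
  also have "\<dots> = (\<Prod>p\<in>I. char D (t * w p))"
  proof (rule prod.cong)
    fix p assume p: "p \<in> I"
    have [measurable]: "X p \<in> borel_measurable M"
      using ind p by (auto simp: indep_vars_def)
    show "char (distr M borel (\<lambda>\<omega>. w p * X p \<omega>)) t = char D (t * w p)"
      unfolding D[OF p, symmetric] char_def by (simp add: integral_distr mult.assoc)
  qed simp
  finally have "cmod (char (distr M borel (\<lambda>\<omega>. \<Sum>p\<in>I. w p * X p \<omega>)) t) =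
      (\<Prod>p\<in>I. cmod (char D (t * w p)))" by (simp add: prod_norm)
  also have "\<dots> \<le> (\<Prod>p\<in>I. exp (- h (t * w p)))"
    using h by (intro prod_mono) auto
  also have "\<dots> = exp (- (\<Sum>p\<in>I. h (t * w p)))"
    using \<open>finite I\<close> by (simp add: exp_sum sum_negf[symmetric])
  finally show ?thesis .
qed

text \<open>The coefficient of \<open>a i j\<close> in \<open>rand_F\<close> at (k pi, l pi), taken
  on index pairs so that the double sum becomes one weighted sum over a single index set.\<close>

definition cos_weight :: "nat \<Rightarrow> nat \<Rightarrow> nat \<Rightarrow> nat \<times> nat \<Rightarrow> real" where
  "cos_weight n k l = (\<lambda>(i, j). cos (real i * (real k * pi) / real n) * cos (real j * (real l * pi) / real n) / real n)"

text \<open>Each weight is at most 1/n in absolute value, so every argument stays in [-c, c] and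
  \<open>freq_decay\<close> is quadratic throughout. The sum then factors into two sums of squared
  cosines, each at least n/2.\<close>

lemma low_freq_decay_sum:
  assumes "n \<ge> 1" "\<bar>t\<bar> \<le> c * real n"
  shows "t\<^sup>2 / 16 \<le> (\<Sum>p\<in>{1..n}\<times>{1..n}. freq_decay c (t * cos_weight n k l p))"
proof -
  let ?C = "\<lambda>k i. cos (real i * (real k * pi) / real n)"
  have "real n / 2 * (real n / 2) \<le> (\<Sum>i = 1..n. (?C k i)\<^sup>2) * (\<Sum>j = 1..n. (?C l j)\<^sup>2)"
    using assms(1) by (intro mult_mono cos_square_sum_ge sum_nonneg) auto
  then have "t\<^sup>2 / (4 * (real n)\<^sup>2) * (real n / 2 * (real n / 2))
      \<le> t\<^sup>2 / (4 * (real n)\<^sup>2) * ((\<Sum>i = 1..n. (?C k i)\<^sup>2) * (\<Sum>j = 1..n. (?C l j)\<^sup>2))"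
    by (intro mult_left_mono) auto
  also have "\<dots> = (\<Sum>i = 1..n. \<Sum>j = 1..n. (t * cos_weight n k l (i, j))\<^sup>2 / 4)"
    unfolding sum_product
    by (simp only: sum_distrib_left, intro sum.cong refl) (simp add: cos_weight_def power_mult_distrib power_divide)
  also have "\<dots> = (\<Sum>i = 1..n. \<Sum>j = 1..n. freq_decay c (t * cos_weight n k l (i, j)))"
  proof (intro sum.cong refl)
    fix i j assume "i \<in> {1..n}" "j \<in> {1..n}"
    have "\<bar>?C k i * ?C l j\<bar> \<le> 1 * 1" unfolding abs_mult by (intro mult_mono) auto
    then have "\<bar>t\<bar> * \<bar>?C k i * ?C l j\<bar> \<le> \<bar>t\<bar> * 1" by (intro mult_left_mono) auto
    then have "\<bar>t * cos_weight n k l (i, j)\<bar> \<le> c"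
      using assms by (simp add: cos_weight_def abs_mult field_simps)
    then show "(t * cos_weight n k l (i, j))\<^sup>2 / 4 = freq_decay c (t * cos_weight n k l (i, j))"
      by (simp add: freq_decay_def)
  qed
  finally show ?thesis using assms(1) by (simp add: sum.cartesian_product power2_eq_square)
qed

text \<open>Arguments beyond c give no decay, so for each j with |cos(jl pi/n)| at least 1/2 one i
  is found whose argument has size between c/4 and c/2. It contributes at least (c/4)^2/4 = c^2/64,
  and there are at least n/4 such j.\<close>

lemma high_freq_decay_sum:
  assumes "n \<ge> 1" "c > 0" "c * real n \<le> \<bar>t\<bar>" "4 * pi * \<bar>t\<bar> \<le> c * real n * sqrt (real n)"
    and "sqrt (real n) \<le> real (add_ord n k)"
  shows "c\<^sup>2 / 256 * real n \<le> (\<Sum>p\<in>{1..n}\<times>{1..n}. freq_decay c (t * cos_weight n k l p))"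
proof -
  let ?C = "\<lambda>k i. cos (real i * (real k * pi) / real n)"
  define B where "B = {j \<in> {1..n}. 1 / 2 \<le> \<bar>?C l j\<bar>}"
  have n: "real n > 0" using assms(1) by simp
  have t: "\<bar>t\<bar> > 0" using assms(2,3) n by (smt (verit) mult_pos_pos)
  have row: "c\<^sup>2 / 64 \<le> (\<Sum>i = 1..n. freq_decay c (t * cos_weight n k l (i, j)))" if "j \<in> B" for j
  proof -
    \<comment> \<open>For fixed j the argument has absolute value w |cos(ik pi/n)|, so |cos(ik
      pi/n)| must hit [c/(4w), c/(2w)]. The bound w >= c/2 puts this window below 1; w <= |t|/n
      makes its length c/(4w) at least pi/sqrt n.\<close>
    define w where "w = \<bar>t\<bar> * \<bar>?C l j\<bar> / real n"
    have "\<bar>t\<bar> * (1 / 2) \<le> \<bar>t\<bar> * \<bar>?C l j\<bar>"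
      using that by (intro mult_left_mono) (auto simp: B_def)
    then have "c / 2 \<le> w" using assms(3) n by (simp add: w_def field_simps)
    then have "w > 0" using assms(2) by simp
    have "\<bar>t\<bar> * \<bar>?C l j\<bar> \<le> \<bar>t\<bar> * 1" by (intro mult_left_mono) auto
    then have w_le: "w \<le> \<bar>t\<bar> / real n" unfolding w_def using n by (intro divide_right_mono) auto
    have "pi / real (add_ord n k) \<le> pi / sqrt (real n)"
      using assms(5) n by (intro divide_left_mono mult_pos_pos less_le_trans[OF _ assms(5)]) auto
    also have "\<dots> \<le> c / (4 * (\<bar>t\<bar> / real n))"
      using assms(4) n t by (simp add: field_simps)
    also have "\<dots> \<le> c / (4 * w)"
      using w_le \<open>w > 0\<close> assms(2) n t by (intro divide_left_mono mult_pos_pos divide_pos_pos) auto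
    also have "\<dots> = c / (2 * w) - c / (4 * w)"
      using \<open>w > 0\<close> by (simp add: field_simps)
    finally obtain i where i: "i \<in> {1..n}" "\<bar>?C k i\<bar> \<in> {c / (4 * w)..c / (2 * w)}"
      using ex_abs_cos_between[OF assms(1), of "c / (4 * w)" "c / (2 * w)" k]
        \<open>c / 2 \<le> w\<close> \<open>w > 0\<close> assms(2) by (auto simp: field_simps)
    define u where "u = t * cos_weight n k l (i, j)"
    have "\<bar>u\<bar> = w * \<bar>?C k i\<bar>"
      by (simp add: u_def w_def cos_weight_def abs_mult)
    then have u: "c / 4 \<le> \<bar>u\<bar>" "\<bar>u\<bar> \<le> c / 2"
      using i(2) \<open>w > 0\<close> by (auto simp: field_simps)
    have "(c / 4)\<^sup>2 \<le> \<bar>u\<bar>\<^sup>2" using u assms(2) by (intro power_mono) auto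
    then have "c\<^sup>2 / 64 \<le> freq_decay c u"
      using u assms(2) by (simp add: freq_decay_def power_divide)
    also have "\<dots> \<le> (\<Sum>i = 1..n. freq_decay c (t * cos_weight n k l (i, j)))"
      unfolding u_def using i(1)
      by (intro member_le_sum[of i "{1..n}" "\<lambda>i. freq_decay c (t * cos_weight n k l (i, j))"])
        (auto simp: freq_decay_nonneg)
    finally show ?thesis .
  qed
  have "c\<^sup>2 / 256 * real n = real n / 4 * (c\<^sup>2 / 64)" by simp
  also have "\<dots> \<le> real (card B) * (c\<^sup>2 / 64)"
    unfolding B_def by (intro mult_right_mono card_cos_ge_half assms) auto
  also have "\<dots> \<le> (\<Sum>j\<in>B. \<Sum>i = 1..n. freq_decay c (t * cos_weight n k l (i, j)))"
    using row by (intro sum_bounded_below) auto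
  also have "\<dots> \<le> (\<Sum>j = 1..n. \<Sum>i = 1..n. freq_decay c (t * cos_weight n k l (i, j)))"
    by (intro sum_mono2 sum_nonneg) (auto simp: B_def freq_decay_nonneg)
  also have "\<dots> = (\<Sum>p\<in>{1..n}\<times>{1..n}. freq_decay c (t * cos_weight n k l p))"
    by (subst sum.swap) (simp add: sum.cartesian_product)
  finally show ?thesis .
qed

section \<open>Choice of scales and conclusion\<close>

text \<open>With T up to n^\<theta> and the Gaussian average cut at n^\<delta>, frequencies reach
  n^(\<theta>+\<delta>). The first condition keeps them in the range of
  \<open>high_freq_decay_sum\<close>; the other two make the high-frequency and tail errors at most
  n^(-\<theta>).\<close>

lemma eventually_scales:
  fixes c \<theta> \<delta> :: real
  assumes "c > 0" "\<theta> > 0" "\<delta> > 0" "\<theta> + \<delta> < 3 / 2"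
  shows "eventually (\<lambda>n::nat. 4 * pi * real n powr (\<theta> + \<delta>) \<le> c * real n * sqrt (real n) \<and>
    exp (- (c\<^sup>2 / 256 * real n)) \<le> 1 / real n powr \<theta> \<and>
    exp (- (real n powr \<delta>)\<^sup>2 / 4) \<le> 1 / real n powr \<theta>) at_top"
proof (intro eventually_conj)
  have "4 * pi > 0" by simp
  with assms show "eventually (\<lambda>n::nat. 4 * pi * real n powr (\<theta> + \<delta>) \<le> c * real n * sqrt (real n)) at_top"
    by real_asymp
  define d where "d = c\<^sup>2 / 256"
  have "d > 0" using assms by (simp add: d_def)
  with assms have "eventually (\<lambda>n::nat. exp (- (d * real n)) \<le> 1 / real n powr \<theta>) at_top"
    by real_asymp
  then show "eventually (\<lambda>n::nat. exp (- (c\<^sup>2 / 256 * real n)) \<le> 1 / real n powr \<theta>) at_top"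
    by (simp add: d_def)
  show "eventually (\<lambda>n::nat. exp (- (real n powr \<delta>)\<^sup>2 / 4) \<le> 1 / real n powr \<theta>) at_top"
    using assms by real_asymp
qed

theorem mainTheorem5:
  fixes M :: "'a measure" and a :: "nat \<Rightarrow> nat \<Rightarrow> 'a \<Rightarrow> real" and \<theta> :: real
  assumes "prob_space M"
    and "prob_space.indep_vars M (\<lambda>_. borel) (\<lambda>(i, j). a i j) ({1..} \<times> {1..})"
    and "\<And>i j. i \<ge> 1 \<Longrightarrow> j \<ge> 1 \<Longrightarrow> distr M borel (a i j) = distr M borel (a 1 1)"
    and "integrable M (a 1 1)"
    and "prob_space.expectation M (a 1 1) = 0"
    and "integrable M (\<lambda>\<omega>. (a 1 1 \<omega>)\<^sup>2)"
    and "prob_space.expectation M (\<lambda>\<omega>. (a 1 1 \<omega>)\<^sup>2) = 1"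
    and "1 < \<theta>" and "\<theta> < 3 / 2"
  shows "\<exists>C > 0. \<forall>n \<ge> 1. \<forall>\<epsilon> > 0. \<forall>k l.
           real (add_ord n k) \<ge> sqrt (real n) \<longrightarrow> real (add_ord n l) \<ge> sqrt (real n) \<longrightarrow>
           measure M {\<omega> \<in> space M. \<bar>rand_F a n (real k * pi) (real l * pi) \<omega>\<bar> \<le> \<epsilon>}
             \<le> C * (\<epsilon> + 1 / real n powr \<theta>)"
proof -
  interpret prob_space M by fact
  define D where "D = distr M borel (a 1 1)"
  have a_meas [measurable]: "a i j \<in> borel_measurable M" if "i \<ge> 1" "j \<ge> 1" for i j
    using assms(2) that by (force simp: indep_vars_def)
  have a11 [measurable]: "a 1 1 \<in> borel_measurable M" by (rule a_meas) auto
  interpret D: real_distribution D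
    unfolding D_def by (rule real_distribution_distr) fact
  obtain c where c: "c > 0" "\<And>t. \<bar>t\<bar> \<le> c \<Longrightarrow> cmod (char D t) \<le> exp (- t\<^sup>2 / 4)"
  proof (rule D.char_le_exp_near_zero)
    show "integrable D (\<lambda>x. x)" "D.expectation (\<lambda>x. x) = 0"
      "integrable D (\<lambda>x. x\<^sup>2)" "D.expectation (\<lambda>x. x\<^sup>2) = 1"
      using assms(4-7) by (simp_all add: D_def integrable_distr_eq integral_distr)
  qed blast
  have decay: "cmod (char D u) \<le> exp (- freq_decay c u)" for u
    using c(2)[of u] D.cmod_char_le_1[of u] by (simp add: freq_decay_def)
  \<comment> \<open>Half of the gap to 3/2: the cutoff n^\<delta> still tends to infinity, yet all
    frequencies stay below order n^(3/2).\<close>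
  define \<delta> where "\<delta> = (3 / 2 - \<theta>) / 2"
  have "\<delta> > 0" "\<theta> + \<delta> < 3 / 2" using assms(9) by (simp_all add: \<delta>_def field_simps)
  then obtain N where N: "\<And>n. n \<ge> N \<Longrightarrow> 4 * pi * real n powr (\<theta> + \<delta>) \<le> c * real n * sqrt (real n)"
      "\<And>n. n \<ge> N \<Longrightarrow> exp (- (c\<^sup>2 / 256 * real n)) \<le> 1 / real n powr \<theta>"
      "\<And>n. n \<ge> N \<Longrightarrow> exp (- (real n powr \<delta>)\<^sup>2 / 4) \<le> 1 / real n powr \<theta>"
    using eventually_scales[of c \<theta> \<delta>] c(1) assms(8) unfolding eventually_sequentially by auto
  \<comment> \<open>The total factor in \<open>prob_le_of_char_bound\<close> once 1/T, r and
    exp(-A^2/4) are each replaced by the common bound \<open>e\<close>.\<close>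
  define K where "K = exp (1 / 2) * (sqrt (2 * pi) * sqrt 8 + 1 + sqrt (2 * pi) * sqrt 2)"
  have "K > 0" by (simp add: K_def add_pos_pos)
  have "measure M {\<omega> \<in> space M. \<bar>rand_F a n (real k * pi) (real l * pi) \<omega>\<bar> \<le> \<epsilon>}
      \<le> (K + real N powr \<theta>) * (\<epsilon> + 1 / real n powr \<theta>)" (is "?P \<le> _")
    if n: "n \<ge> 1" and \<epsilon>: "\<epsilon> > 0" and k: "sqrt (real n) \<le> real (add_ord n k)" for n \<epsilon> k l
  proof (cases "n < N")
    \<comment> \<open>Below the threshold \<open>N\<close> the summand N^\<theta> of the constant
      alone makes the right-hand side at least 1.\<close>
    case True
    have "?P \<le> 1" by simp
    also have "1 \<le> real N powr \<theta> * (1 / real n powr \<theta>)"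
      using True n assms(8) powr_mono2[of \<theta> "real n" "real N"] by simp
    also have "\<dots> \<le> (K + real N powr \<theta>) * (\<epsilon> + 1 / real n powr \<theta>)"
      using \<open>K > 0\<close> \<epsilon> by (intro mult_mono) auto
    finally show ?thesis .
  next
    case False
    then have nN: "n \<ge> N" by simp
    let ?I = "{1..n} \<times> {1..n}"
    define X where "X = (\<lambda>\<omega>. \<Sum>p\<in>?I. cos_weight n k l p * (case p of (i, j) \<Rightarrow> a i j) \<omega>)"
    have F_eq: "rand_F a n (real k * pi) (real l * pi) = X"
      unfolding X_def rand_F_def cos_weight_def
      by (intro ext) (simp add: sum_distrib_left sum.cartesian_product split_beta mult_ac)
    have X_meas [measurable]: "X \<in> borel_measurable M"
      unfolding X_def by (intro borel_measurable_sum borel_measurable_times) auto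
    interpret X: real_distribution "distr M borel X" by (rule real_distribution_distr) fact
    have char_X: "cmod (char (distr M borel X) t) \<le>
        exp (- (\<Sum>p\<in>?I. freq_decay c (t * cos_weight n k l p)))" for t
      unfolding X_def
    proof (rule cmod_char_weighted_sum_le[where D = D])
      show "indep_vars (\<lambda>_. borel) (\<lambda>p. case p of (i, j) \<Rightarrow> a i j) ?I"
        using assms(2) by (rule indep_vars_subset) auto
      show "distr M borel (case p of (i, j) \<Rightarrow> a i j) = D" if "p \<in> ?I" for p
        using that assms(3)[of "fst p" "snd p"] by (simp add: D_def split_beta mem_Times_iff)
    qed (use decay in auto)
    \<comment> \<open>Raising \<epsilon> to at least n^(-\<theta>) caps T at n^\<theta>, and the
      claimed bound absorbs the change.\<close>
    define e T where "e = max \<epsilon> (1 / real n powr \<theta>)" and "T = 1 / e"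
    have "e > 0" "T > 0" "\<epsilon> \<le> e" "e \<le> \<epsilon> + 1 / real n powr \<theta>"
      using \<epsilon> by (auto simp: e_def T_def)
    have "T \<le> real n powr \<theta>"
    proof -
      have "1 / e \<le> 1 / (1 / real n powr \<theta>)"
        using n \<open>e > 0\<close> by (intro divide_left_mono mult_pos_pos) (auto simp: e_def)
      then show ?thesis by (simp add: T_def)
    qed
    \<comment> \<open>Low frequencies give the Gaussian term and high ones the term exponentially
      small in n; adding both covers either case.\<close>
    have bound: "cmod (char (distr M borel X) (T * z)) \<le>
        exp (- (T * z)\<^sup>2 / 16) + exp (- (c\<^sup>2 / 256 * real n))" if z: "\<bar>z\<bar> \<le> real n powr \<delta>" for z
    proof (cases "\<bar>T * z\<bar> \<le> c * real n")
      case True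
      have "exp (- (\<Sum>p\<in>?I. freq_decay c (T * z * cos_weight n k l p))) \<le> exp (- (T * z)\<^sup>2 / 16)"
        using low_freq_decay_sum[OF n True, of k l] by simp
      with char_X[of "T * z"] show ?thesis by (smt (verit) exp_gt_zero)
    next
      case False
      have "\<bar>T * z\<bar> \<le> real n powr \<theta> * real n powr \<delta>"
        unfolding abs_mult using \<open>T > 0\<close> \<open>T \<le> real n powr \<theta>\<close> z by (intro mult_mono) auto
      then have "4 * pi * \<bar>T * z\<bar> \<le> 4 * pi * real n powr (\<theta> + \<delta>)"
        by (intro mult_left_mono) (auto simp: powr_add)
      also note N(1)[OF nN]
      finally have "exp (- (\<Sum>p\<in>?I. freq_decay c (T * z * cos_weight n k l p)))
          \<le> exp (- (c\<^sup>2 / 256 * real n))"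
        using high_freq_decay_sum[OF n c(1), of "T * z" k l] False k by simp
      with char_X[of "T * z"] show ?thesis by (smt (verit) exp_gt_zero)
    qed
    have "?P \<le> prob {\<omega> \<in> space M. \<bar>X \<omega>\<bar> \<le> 1 / T}"
      unfolding F_eq using \<open>\<epsilon> \<le> e\<close> by (intro finite_measure_mono) (auto simp: T_def)
    also have "\<dots> = X.prob {x. \<bar>x\<bar> \<le> 1 / T}"
      by (subst measure_distr) (auto intro!: arg_cong[where f = prob])
    also have "\<dots> \<le> exp (1 / 2) * (sqrt (2 * pi) * sqrt 8 / T + exp (- (c\<^sup>2 / 256 * real n))
        + exp (- (real n powr \<delta>)\<^sup>2 / 4) * (sqrt (2 * pi) * sqrt 2))"
      by (rule X.prob_le_of_char_bound[OF \<open>T > 0\<close> _ _ bound]) auto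
    also have "\<dots> \<le> exp (1 / 2) * (sqrt (2 * pi) * sqrt 8 * e + e + e * (sqrt (2 * pi) * sqrt 2))"
    proof -
      have "1 / real n powr \<theta> \<le> e" by (simp add: e_def)
      with N(2,3)[OF nN] have "exp (- (c\<^sup>2 / 256 * real n)) \<le> e" "exp (- (real n powr \<delta>)\<^sup>2 / 4) \<le> e"
        by linarith+
      then show ?thesis by (intro mult_left_mono add_mono mult_right_mono) (auto simp: T_def)
    qed
    also have "\<dots> = K * e" by (simp add: K_def algebra_simps)
    also have "\<dots> \<le> (K + real N powr \<theta>) * (\<epsilon> + 1 / real n powr \<theta>)"
      using \<open>K > 0\<close> \<open>e > 0\<close> \<open>e \<le> \<epsilon> + 1 / real n powr \<theta>\<close> by (intro mult_mono) auto
    finally show ?thesis .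
  qed
  moreover have "K + real N powr \<theta> > 0" using \<open>K > 0\<close> by (simp add: add_pos_nonneg)
  ultimately show ?thesis by blast
qed

end
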